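(* The ring $R=\mathbb{F}_2\langle a,x : a=a^2x\rangle$ is both left linearly McCoy and right linearly McCoy.
   Context: $R=\mathbb{F}_2\langle a,x: a=a^2x\rangle$ denotes the quotient of the free unital associative (noncommutative) $\mathbb{F}_2$-algebra on two generators $a,x$ by the two-sided ideal generated by $a-a^2x$. For a ring $S$, let $S[t]$ be the polynomial ring in a central indeterminate $t$. $S$ is right linearly McCoy if for any two nonzero polynomials $f,g\in S[t]$ of degree at most $1$ with $fg=0$, there exists a nonzero $s\in S$ with $fs=0$. $S$ is left linearly McCoy if for any two nonzero polynomials $f,g\in S[t]$ of degree at most $1$ with $fg=0$, there exists a nonzero $s\in S$ with $sg=0$. *)

theory Defs
  imports
    "HOL-Algebra.UnivPoly"
    "HOL-Algebra.QuotRing"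
    "HOL-Algebra.Algebraic_Closure_Type"
    "HOL-Library.Poly_Mapping"
    "HOL-Library.Z2"
begin

section \<open>Free algebras\<close>

text \<open>
  The monoid operation is written additively although it is not commutative: the
  multiplication of \<^typ>\<open>'m \<Rightarrow>\<^sub>0 'k\<close> is convolution with respect to addition of keys.
\<close>

datatype 'g free_monoid = Letters (letters: "'g list")

instantiation free_monoid :: (type) monoid_add
begin

definition zero_free_monoid :: "'a free_monoid" where
  "0 = Letters []"

definition plus_free_monoid :: "'a free_monoid \<Rightarrow> 'a free_monoid \<Rightarrow> 'a free_monoid" where
  "u + v = Letters (letters u @ letters v)"

instance
  by standard (simp_all add: zero_free_monoid_def plus_free_monoid_def)

end

text \<open>
  The free unital associative algebra over \<open>'k\<close> on the set of all elements of \<open>'g\<close>, as the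
  monoid algebra of the free monoid.
\<close>

type_synonym ('g, 'k) free_algebra = "'g free_monoid \<Rightarrow>\<^sub>0 'k"

definition gen :: "'g \<Rightarrow> ('g, 'k::zero_neq_one) free_algebra" where
  "gen g = Poly_Mapping.single (Letters [g]) 1"


section \<open>The ring \<open>\<F>\<^sub>2\<langle>a, x : a = a\<^sup>2x\<rangle>\<close>\<close>

datatype generator = Gen_a | Gen_x

text \<open>The field with two elements is \<^typ>\<open>bit\<close>.\<close>

abbreviation F2_free :: "(generator, bit) free_algebra ring" where
  "F2_free \<equiv> ring_of_type_algebra"

definition relator :: "(generator, bit) free_algebra" where
  "relator = gen Gen_a - gen Gen_a ^ 2 * gen Gen_x"

definition ring_R :: "(generator, bit) free_algebra set ring" where
  "ring_R = F2_free Quot (Idl\<^bsub>F2_free\<^esub> {relator})"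

text \<open>
  The library proves this only for commutative rings, where it is called
  \<open>ring_from_type_algebra\<close>.
\<close>

lemma (in ring_1) ring_ring_of_type_algebra:
  "ring (ring_of_type_algebra :: 'a ring)"
proof -
  have "\<exists>y. y + x = 0 \<and> x + y = 0" for x :: 'a
    by (rule exI[of _ "- x"]) simp
  thus ?thesis
    unfolding ring_of_type_algebra_def
    by unfold_locales (auto simp: algebra_simps Units_def)
qed

lemma ring_ring_R: "ring ring_R"
  unfolding ring_R_def
  by (intro ideal.quotient_is_ring ring.genideal_ideal ring_ring_of_type_algebra)
     (simp add: ring_of_type_algebra_def)


section \<open>Linearly McCoy rings\<close>

text \<open>
  \<open>S[t]\<close> is \<^term>\<open>UP S\<close>, and \<^term>\<open>up_ring.monom (UP S) s 0\<close> is the constant polynomial \<open>s\<close>. The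
  degree \<^const>\<open>deg\<close> of the zero polynomial is \<open>0\<close>.
\<close>

definition right_linearly_McCoy :: "('a, 'm) ring_scheme \<Rightarrow> bool" where
  "right_linearly_McCoy S \<longleftrightarrow>
    (\<forall>f \<in> carrier (UP S) - {\<zero>\<^bsub>UP S\<^esub>}. \<forall>g \<in> carrier (UP S) - {\<zero>\<^bsub>UP S\<^esub>}.
      deg S f \<le> 1 \<and> deg S g \<le> 1 \<and> f \<otimes>\<^bsub>UP S\<^esub> g = \<zero>\<^bsub>UP S\<^esub> \<longrightarrow>
      (\<exists>s \<in> carrier S - {\<zero>\<^bsub>S\<^esub>}. f \<otimes>\<^bsub>UP S\<^esub> up_ring.monom (UP S) s 0 = \<zero>\<^bsub>UP S\<^esub>))"

definition left_linearly_McCoy :: "('a, 'm) ring_scheme \<Rightarrow> bool" where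
  "left_linearly_McCoy S \<longleftrightarrow>
    (\<forall>f \<in> carrier (UP S) - {\<zero>\<^bsub>UP S\<^esub>}. \<forall>g \<in> carrier (UP S) - {\<zero>\<^bsub>UP S\<^esub>}.
      deg S f \<le> 1 \<and> deg S g \<le> 1 \<and> f \<otimes>\<^bsub>UP S\<^esub> g = \<zero>\<^bsub>UP S\<^esub> \<longrightarrow>
      (\<exists>s \<in> carrier S - {\<zero>\<^bsub>S\<^esub>}. up_ring.monom (UP S) s 0 \<otimes>\<^bsub>UP S\<^esub> g = \<zero>\<^bsub>UP S\<^esub>))"

end

theory Submission
  imports Defs
begin

text \<open>
  Write \<open>z = 1 + ax\<close>, which is \<open>1 - ax\<close> in characteristic 2. The relation says \<open>a z = 0\<close>. The words
  without the factor \<open>aax\<close> form a basis of \<open>R\<close>, and they are the products \<open>w a\<^sup>i\<close> with \<open>w\<close> a word in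
  \<open>x\<close> and \<open>ax\<close>. So \<open>R\<close> is a free left module with basis \<open>1, a, a\<^sup>2, \<dots>\<close> over the subalgebra \<open>T\<close>
  generated by \<open>x\<close> and \<open>z\<close>, which is free on these two elements. Everything follows from one claim:
  if \<open>f g = 0\<close> and \<open>g \<noteq> 0\<close> in \<open>R\<close>, then \<open>f \<in> R a\<close>, that is, the coefficient \<open>f\<^sub>0 \<in> T\<close> of
  \<open>a\<^sup>0\<close> in \<open>f\<close> is zero.

  By the claim, \<open>f z = 0\<close> for all left zero-divisors \<open>f\<close>. If also \<open>f \<noteq> 0\<close>, write \<open>f = f' a\<close>; then
  \<open>f' (a g) = 0\<close> with \<open>f'\<close> of smaller degree in \<open>a\<close>, and repeating this shows that each right
  zero-divisor \<open>g\<close> is annihilated by some \<open>a\<^sup>k\<close>. If the product of two nonzero polynomials of degree at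
  most 1 is zero, then all coefficients of the first are left zero-divisors and all coefficients of
  the second are right zero-divisors. Hence \<open>z\<close> annihilates the first polynomial from the right, and a
  large power of \<open>a\<close> annihilates the second from the left.

  For the claim, assume \<open>f\<^sub>0 \<noteq> 0\<close>. Right multiplication by \<open>x\<close> is injective and lowers the degree in
  \<open>a\<close>, so \<open>g\<close> may be taken in \<open>T\<close>. Let \<open>g = c + x p + z q\<close> with \<open>c \<in> \<F>\<^sub>2\<close>. Here \<open>f z = f\<^sub>0 z\<close>, while
  \<open>f x = (f\<^sub>0 x + f\<^sub>1 (1 + z)) + f\<^sub>2 a + \<dots>\<close> has smaller degree in \<open>a\<close> than \<open>f\<close>. Comparing leading
  coefficients gives \<open>c = 0\<close> unless \<open>f \<in> T\<close>, and then \<open>f g = (f x) p + f\<^sub>0 z q\<close>. This suggests an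
  induction on the degree of \<open>f\<close> in \<open>a\<close> for a stronger statement: if \<open>f g \<in> U\<close> for a right ideal \<open>U\<close> of
  \<open>T\<close>, then \<open>g = 0\<close> (lemma \<open>nf_act_embed_in_ideal_imp_zero\<close>). One step replaces \<open>U\<close> by \<open>U + f\<^sub>0 z T\<close>
  and \<open>f\<^sub>0\<close> by \<open>f\<^sub>0 x + f\<^sub>1 (1 + z)\<close>. What is needed is a condition on the pair \<open>(U, f\<^sub>0)\<close> that is preserved
  by this step for every \<open>f\<^sub>1\<close> and under which \<open>f\<^sub>0 g \<in> U\<close> implies \<open>g = 0\<close>.

  The condition is \<open>lead_independent\<close>: for a shortest element \<open>h\<close> of \<open>f\<^sub>0 + U\<close>, the leading form of
  \<open>h\<close> is not that of an element of \<open>U\<close>, and the right ideal of leading forms of \<open>U\<close> is generated in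
  lengths up to that of \<open>h\<close>. It implies \<open>f\<^sub>0 T \<inter> U = 0\<close> by the argument of the weak algorithm
  (\<open>lead_independent_mult_notin\<close>). It is preserved (\<open>lead_independent_enlarge\<close>) because \<open>f\<^sub>1\<close> may be
  shortened modulo \<open>U + f\<^sub>0 z T\<close>; after that, the leading form of \<open>h x + f\<^sub>1 (1 + z)\<close> contains that of
  \<open>h x\<close> or equals that of \<open>f\<^sub>1 z\<close>, depending on which of \<open>h\<close> and \<open>f\<^sub>1\<close> is longer.
\<close>

section \<open>Free algebras over the field with two elements\<close>

lemma free_algebra_add_self [simp]: "f + f = 0"
  for f :: "('g, bit) free_algebra"
  by (rule poly_mapping_eqI) (simp add: lookup_add)

lemma free_algebra_minus_eq_plus: "f - g = f + g"
  for f g :: "('g, bit) free_algebra"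
proof -
  have "f - g = f - g + (g + g)"
    unfolding free_algebra_add_self by (rule add_0_right[symmetric])
  also have "\<dots> = f + g"
    unfolding add.assoc[symmetric] diff_add_cancel ..
  finally show ?thesis .
qed

lemma Letters_add: "Letters u + Letters v = Letters (u @ v)"
  by (simp add: plus_free_monoid_def)

lemma Letters_Nil: "Letters [] = 0"
  by (simp add: zero_free_monoid_def)

lemma single_snoc: "Poly_Mapping.single (Letters (w @ [l])) 1 = 
    (Poly_Mapping.single (Letters w) 1 :: ('g, bit) free_algebra) * gen l"
  by (simp add: gen_def mult_single Letters_add)

lemma single_Cons: "Poly_Mapping.single (Letters (l # w)) 1 = 
    (gen l :: ('g, bit) free_algebra) * Poly_Mapping.single (Letters w) 1"
  by (simp add: gen_def mult_single Letters_add)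

lemma free_algebra_word_induct [case_names zero word add]:
  fixes f :: "('g, bit) free_algebra"
  assumes "P 0" and word: "\<And>w. P (Poly_Mapping.single (Letters w) 1)"
    and "\<And>f g. P f \<Longrightarrow> P g \<Longrightarrow> P (f + g)"
  shows "P f"
proof (induction f rule: update_induct)
  case const
  show ?case by fact
next
  case (update f w b)
  have "Poly_Mapping.update w b f = f + Poly_Mapping.single w b"
    using update.hyps
    by (intro poly_mapping_eqI) (auto simp: lookup_add lookup_update lookup_single in_keys_iff when_def)
  moreover have "b = 1"
    using \<open>b \<noteq> 0\<close> by simp
  moreover have "P (Poly_Mapping.single w 1)"
    using word[of "letters w"] by simp
  ultimately show ?case
    using update.IH assms(3) by simp
qed

lemma free_algebra_snoc_induct [case_names zero one snoc add]:
  fixes f :: "('g, bit) free_algebra"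
  assumes "P 0" "P 1" "\<And>f l. P f \<Longrightarrow> P (f * gen l)" "\<And>f g. P f \<Longrightarrow> P g \<Longrightarrow> P (f + g)"
  shows "P f"
proof (induction f rule: free_algebra_word_induct)
  case (word w)
  show ?case
    by (induction w rule: rev_induct) (simp_all add: Letters_Nil assms single_snoc)
qed (use assms in auto)

lemma free_algebra_Cons_induct [case_names zero one Cons add]:
  fixes f :: "('g, bit) free_algebra"
  assumes "P 0" "P 1" "\<And>f l. P f \<Longrightarrow> P (gen l * f)" "\<And>f g. P f \<Longrightarrow> P g \<Longrightarrow> P (f + g)"
  shows "P f"
proof (induction f rule: free_algebra_word_induct)
  case (word w)
  show ?case
    by (induction w) (simp_all add: Letters_Nil assms single_Cons)
qed (use assms in auto)

text \<open>
  The cofactor of the letter \<open>l\<close> when every nonempty word of \<open>f\<close> is split into its last letter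
  and the rest, so that \<open>f = aug f + (\<Sum>l. right_deriv l f * gen l)\<close>.
\<close>

definition right_deriv :: "'g \<Rightarrow> ('g, bit) free_algebra \<Rightarrow> ('g, bit) free_algebra" where
  "right_deriv l f = Poly_Mapping.map_key (\<lambda>w. w + Letters [l]) f"

definition aug :: "('g, bit) free_algebra \<Rightarrow> ('g, bit) free_algebra" where
  "aug f = Poly_Mapping.single 0 (Poly_Mapping.lookup f 0)"

lemma inj_snoc: "inj (\<lambda>w. w + Letters [l])"
  by (auto intro!: injI simp: plus_free_monoid_def free_monoid.expand)

lemma lookup_right_deriv: "Poly_Mapping.lookup (right_deriv l f) w = Poly_Mapping.lookup f (w + Letters [l])"
  by (simp add: right_deriv_def map_key.rep_eq inj_snoc)

lemma right_deriv_zero [simp]: "right_deriv l 0 = 0"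
  by (rule poly_mapping_eqI) (simp add: lookup_right_deriv)

lemma right_deriv_add: "right_deriv l (f + g) = right_deriv l f + right_deriv l g"
  by (rule poly_mapping_eqI) (simp add: lookup_right_deriv lookup_add)

lemma right_deriv_diff: "right_deriv l (f - g) = right_deriv l f - right_deriv l g"
  by (rule poly_mapping_eqI) (simp add: lookup_right_deriv lookup_minus)

lemma snoc_neq_zero: "w + Letters [l] \<noteq> 0" "0 \<noteq> w + Letters [l]"
  by (simp_all add: plus_free_monoid_def zero_free_monoid_def)

lemma right_deriv_one [simp]: "right_deriv l 1 = 0"
  by (rule poly_mapping_eqI) (simp add: lookup_right_deriv lookup_one snoc_neq_zero)

lemma right_deriv_mult_gen: "right_deriv l (f * gen l') = (if l = l' then f else 0)"
proof (induction f rule: free_algebra_word_induct)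
  case (word w)
  show ?case
  proof (rule poly_mapping_eqI)
    fix u
    have "Letters (w @ [l']) = u + Letters [l] \<longleftrightarrow> l = l' \<and> Letters w = u"
      by (cases u) (auto simp: plus_free_monoid_def)
    then show "Poly_Mapping.lookup (right_deriv l (Poly_Mapping.single (Letters w) 1 * gen l')) u =
        Poly_Mapping.lookup (if l = l' then Poly_Mapping.single (Letters w) 1 else 0) u"
      unfolding single_snoc[symmetric] lookup_right_deriv by (simp add: lookup_single when_def)
  qed
qed (auto simp: right_deriv_add distrib_right)

lemma aug_add: "aug (f + g) = aug f + aug g"
  unfolding aug_def lookup_add single_add ..

lemma aug_cases: "aug f = 0 \<or> aug f = 1"
  by (cases "Poly_Mapping.lookup f 0") (simp_all add: aug_def)

lemma aug_zero [simp]: "aug 0 = 0" and aug_one [simp]: "aug 1 = 1"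
  by (simp_all add: aug_def)

lemma aug_mult_gen [simp]: "aug (f * gen l) = 0"
proof (induction f rule: free_algebra_word_induct)
  case (word w)
  have "Letters (w @ [l]) \<noteq> (0 :: 'a free_monoid)"
    by (simp add: zero_free_monoid_def)
  then show ?case
    by (simp add: aug_def lookup_single_not_eq flip: single_snoc)
qed (simp_all add: distrib_right aug_add)

text \<open>
  Splitting off the last letter of \<open>g\<close> leaves \<open>f\<close> untouched, and the last letter of \<open>f\<close> is
  exposed only by the constant term of \<open>g\<close>.
\<close>

lemma right_deriv_mult: "right_deriv l (f * g) = f * right_deriv l g + right_deriv l f * aug g"
proof (induction g rule: free_algebra_snoc_induct)
  case (snoc g l')
  then show ?case
    by (simp add: right_deriv_mult_gen flip: mult.assoc)
qed (simp_all add: algebra_simps right_deriv_add aug_add)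

lemma right_deriv_gen: "right_deriv l (gen l') = (if l = l' then 1 else 0)"
  using right_deriv_mult_gen[of l 1 l'] by simp

lemma eq_aug_if_right_deriv_eq_0:
  assumes "\<And>l. right_deriv l f = 0" shows "f = aug f"
proof (rule poly_mapping_eqI)
  fix w
  show "Poly_Mapping.lookup f w = Poly_Mapping.lookup (aug f) w"
  proof (cases "letters w" rule: rev_cases)
    case Nil
    then have "w = 0" by (simp add: zero_free_monoid_def free_monoid.expand)
    then show ?thesis by (simp add: aug_def)
  next
    case (snoc u l)
    then have w: "w = Letters u + Letters [l]"
      by (simp add: plus_free_monoid_def free_monoid.expand)
    have "Poly_Mapping.lookup f w = 0"
      using arg_cong[OF assms[of l], of "\<lambda>f. Poly_Mapping.lookup f (Letters u)"]
      by (simp add: lookup_right_deriv w)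
    then show ?thesis
      using lookup_single_not_eq[OF snoc_neq_zero(2)] by (simp add: w aug_def)
  qed
qed

section \<open>Length of elements of a free algebra\<close>

text \<open>
  \<open>short n f\<close> means that all words of \<open>f\<close> have length less than \<open>n\<close>. The recursion through
  \<^const>\<open>right_deriv\<close> makes inductions on the length follow the product rule.
\<close>

primrec short :: "nat \<Rightarrow> ('g, bit) free_algebra \<Rightarrow> bool" where
  "short 0 f \<longleftrightarrow> f = 0"
| "short (Suc n) f \<longleftrightarrow> (\<forall>l. short n (right_deriv l f))"

lemma short_zero [simp]: "short n 0"
  by (induction n) auto

lemma short_add: "short n f \<Longrightarrow> short n g \<Longrightarrow> short n (f + g)"
  by (induction n arbitrary: f g) (auto simp: right_deriv_add)

lemma short_diff: "short n f \<Longrightarrow> short n g \<Longrightarrow> short n (f - g)"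
  by (simp add: free_algebra_minus_eq_plus short_add)

lemma short_Suc: "short n f \<Longrightarrow> short (Suc n) f"
  by (induction n arbitrary: f) auto

lemma short_mono:
  assumes "short m f" "m \<le> n" shows "short n f"
  using assms(2) by (induction n rule: dec_induct) (use assms(1) short_Suc in blast)+

lemma short_right_deriv: "short (Suc n) f \<Longrightarrow> short n (right_deriv l f)"
  by simp

lemma ex_short: "\<exists>n. short n f"
proof (induction f rule: free_algebra_snoc_induct)
  case one
  show ?case by (intro exI[of _ 1]) simp
next
  case (snoc f l)
  then obtain n where "short n f" by blast
  then have "short (Suc n) (f * gen l)" by (simp add: right_deriv_mult_gen)
  then show ?case by blast
next
  case (add f g)
  then obtain m n where "short m f" "short n g" by blast
  then have "short (max m n) (f + g)"
    using short_mono[of m f "max m n"] short_mono[of n g "max m n"] short_add by simp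
  then show ?case by blast
qed auto

lemma ex_length:
  assumes "f \<noteq> 0" obtains n where "short (Suc n) f" "\<not> short n f"
proof -
  define N where "N = (LEAST n. short n f)"
  have N: "short N f"
    unfolding N_def using ex_short[of f] by (metis LeastI_ex)
  then obtain n where "N = Suc n"
    using assms by (cases N) auto
  moreover from this have "\<not> short n f"
    using not_less_Least[of n "\<lambda>n. short n f"] by (simp add: N_def)
  ultimately show thesis using N that by metis
qed

lemma short_mult_aug: "short n f \<Longrightarrow> short n (f * aug g)"
  using aug_cases[of g] by auto

text \<open>
  The length of a product is at most the sum of the lengths. The second factor carries the
  strict bound, since it may then be zero.
\<close>

lemma short_mult:
  assumes "short (Suc m) f" "short n g" shows "short (m + n) (f * g)"
  using assms(2)
proof (induction n arbitrary: g)
  case (Suc n)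
  have "short (m + n) (f * right_deriv l g)" for l
    using Suc by simp
  moreover have "short (m + n) (right_deriv l f * aug g)" for l
    by (rule short_mult_aug, rule short_mono[OF short_right_deriv[OF assms(1)]]) simp
  ultimately show ?case
    by (simp add: right_deriv_mult short_add)
qed simp

lemma short_one_imp: "short (Suc 0) f \<Longrightarrow> f = 0 \<or> f = 1"
  using eq_aug_if_right_deriv_eq_0[of f] aug_cases[of f] by auto

section \<open>Right ideals and leading forms\<close>

definition right_ideal :: "'a::ring_1 set \<Rightarrow> bool" where
  "right_ideal U \<longleftrightarrow> 0 \<in> U \<and> (\<forall>u\<in>U. \<forall>v\<in>U. u + v \<in> U) \<and> (\<forall>u\<in>U. \<forall>t. u * t \<in> U)"

lemma right_ideal_zero: "right_ideal U \<Longrightarrow> 0 \<in> U"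
  and right_ideal_add: "right_ideal U \<Longrightarrow> u \<in> U \<Longrightarrow> v \<in> U \<Longrightarrow> u + v \<in> U"
  and right_ideal_mult: "right_ideal U \<Longrightarrow> u \<in> U \<Longrightarrow> u * t \<in> U"
  by (auto simp: right_ideal_def)

lemma right_ideal_uminus: "right_ideal U \<Longrightarrow> u \<in> U \<Longrightarrow> - u \<in> U"
  using right_ideal_mult[of U u "-1"] by simp

lemma right_ideal_diff: "right_ideal U \<Longrightarrow> u \<in> U \<Longrightarrow> v \<in> U \<Longrightarrow> u - v \<in> U"
  using right_ideal_add[of U u "-v"] right_ideal_uminus by fastforce

text \<open>
  For an element of length \<open>m\<close>, membership in \<open>near U m\<close> says that its leading form is also the
  leading form of an element of \<open>U\<close>.
\<close>

definition near :: "('g, bit) free_algebra set \<Rightarrow> nat \<Rightarrow> ('g, bit) free_algebra set" where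
  "near U m = {f. \<exists>u\<in>U. short m (f - u)}"

lemma nearI: "u \<in> U \<Longrightarrow> short m (f - u) \<Longrightarrow> f \<in> near U m"
  by (auto simp: near_def)

lemma nearE: assumes "f \<in> near U m" obtains u where "u \<in> U" "short m (f - u)"
  using assms by (auto simp: near_def)

lemma near_mono: "f \<in> near U m \<Longrightarrow> U \<subseteq> V \<Longrightarrow> m \<le> n \<Longrightarrow> f \<in> near V n"
  unfolding near_def by (blast intro: short_mono)

lemma mem_near: "u \<in> U \<Longrightarrow> u \<in> near U m"
  by (auto intro: nearI)

lemma short_near: "right_ideal U \<Longrightarrow> short m f \<Longrightarrow> f \<in> near U m"
  by (auto intro: nearI[of 0] right_ideal_zero)

lemma near_add: "right_ideal U \<Longrightarrow> f \<in> near U m \<Longrightarrow> g \<in> near U m \<Longrightarrow> f + g \<in> near U m"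
proof -
  assume U: "right_ideal U" and "f \<in> near U m" "g \<in> near U m"
  then obtain u v where "u \<in> U" "v \<in> U" and *: "short m (f - u)" "short m (g - v)"
    by (auto elim!: nearE)
  moreover have "short m ((f + g) - (u + v))"
    using short_add[OF *] by (simp add: add_diff_add)
  ultimately show "f + g \<in> near U m"
    using U by (blast intro: nearI right_ideal_add)
qed

lemma near_diff: "right_ideal U \<Longrightarrow> f \<in> near U m \<Longrightarrow> g \<in> near U m \<Longrightarrow> f - g \<in> near U m"
  by (simp add: free_algebra_minus_eq_plus near_add)

text \<open>
  The leading forms of elements of \<open>U\<close> have no generators in lengths above \<open>m\<close>: if the leading
  form of \<open>u\<close> has length \<open>n + 1 > m\<close>, then the cofactors of its last letters are leading forms of
  elements of \<open>U\<close> of length \<open>n\<close>. The condition is phrased modulo elements shorter than \<open>n\<close>,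
  so no leading forms have to be named.
\<close>

definition lead_generated :: "('g, bit) free_algebra set \<Rightarrow> nat \<Rightarrow> bool" where
  "lead_generated U m \<longleftrightarrow>
    (\<forall>u\<in>U. \<forall>n\<ge>m. short (Suc (Suc n)) u \<longrightarrow> (\<forall>l. right_deriv l u \<in> near U n))"

lemma lead_generated_mono: "lead_generated U m \<Longrightarrow> m \<le> n \<Longrightarrow> lead_generated U n"
  by (auto simp: lead_generated_def)

lemma lead_generatedD: 
  "lead_generated U m \<Longrightarrow> u \<in> U \<Longrightarrow> m \<le> n \<Longrightarrow> short (Suc (Suc n)) u \<Longrightarrow> right_deriv l u \<in> near U n"
  by (auto simp: lead_generated_def)

text \<open>
  An instance of the weak algorithm of free algebras. If the leading form of \<open>f * s\<close> were
  that of an element of \<open>U\<close>, then the letters of a longest word of \<open>s\<close> could be split off one after another, since all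
  lengths met on the way exceed \<open>m\<close>; what remains at the end is the leading form of \<open>f\<close>.
\<close>

lemma mult_notin_near:
  assumes U: "right_ideal U" "lead_generated U m"
    and f: "short (Suc m) f" "f \<notin> near U m"
    and s: "short (Suc k) s" "\<not> short k s"
  shows "f * s \<notin> near U (m + k)"
  using s
proof (induction k arbitrary: s)
  case 0
  then show ?case
    using short_one_imp[of s] f by auto
next
  case (Suc k)
  from Suc.prems obtain l where l: "\<not> short k (right_deriv l s)" by auto
  have *: "f * right_deriv l s \<notin> near U (m + k)"
    using Suc.IH[of "right_deriv l s"] Suc.prems l by simp
  show ?case
  proof
    assume "f * s \<in> near U (m + Suc k)"
    then obtain u where u: "u \<in> U" "short (m + Suc k) (f * s - u)" by (rule nearE)
    have "short (m + Suc (Suc k)) (f * s)"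
      using short_mult[OF f(1) Suc.prems(1)] .
    from short_diff[OF this short_Suc[OF u(2), folded add_Suc_right]]
    have "short (Suc (Suc (m + k))) u" by simp
    then have "right_deriv l u \<in> near U (m + k)"
      using lead_generatedD[OF U(2) u(1)] by simp
    moreover have "right_deriv l (f * s - u) \<in> near U (m + k)"
      using u(2) by (intro short_near U) simp
    moreover have "right_deriv l f * aug s \<in> near U (m + k)"
      by (rule short_near[OF U(1)], rule short_mult_aug, rule short_mono[OF short_right_deriv[OF f(1)]]) simp
    ultimately have "right_deriv l (f * s - u) + right_deriv l u - right_deriv l f * aug s \<in> near U (m + k)"
      by (intro near_add near_diff U)
    then show False
      using * by (simp add: right_deriv_diff right_deriv_mult)
  qed
qed

text \<open>
  The invariant of the main induction. It depends on \<open>f\<close> only modulo \<open>U\<close>, and a shortest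
  representative \<open>g\<close> witnesses it.
\<close>

definition lead_independent :: "('g, bit) free_algebra set \<Rightarrow> ('g, bit) free_algebra \<Rightarrow> bool" where
  "lead_independent U f \<longleftrightarrow> (\<exists>m g. f - g \<in> U \<and> short (Suc m) g \<and> g \<notin> near U m \<and> lead_generated U m)"

lemma lead_independent_mult_notin:
  assumes U: "right_ideal U" and "lead_independent U f" "f * s \<in> U"
  shows "s = 0"
proof (rule ccontr)
  assume "s \<noteq> 0"
  then obtain k where k: "short (Suc k) s" "\<not> short k s" by (rule ex_length)
  obtain m g where g: "f - g \<in> U" "short (Suc m) g" "g \<notin> near U m" "lead_generated U m"
    using assms by (auto simp: lead_independent_def)
  have "f * s - (f - g) * s \<in> U"
    by (rule right_ideal_diff[OF U assms(3) right_ideal_mult[OF U g(1)]])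
  then have "g * s \<in> U" by (simp add: algebra_simps)
  then show False
    using mult_notin_near[OF U g(4,2,3) k] mem_near by blast
qed

lemma zero_right_ideal: "right_ideal {0}"
  by (auto simp: right_ideal_def)

lemma lead_generated_zero: "lead_generated {0} m"
  by (auto simp: lead_generated_def near_def)

lemma near_zero: "near {0} m = {f. short m f}"
  by (auto simp: near_def)

lemma lead_independent_zero_ideal: "f \<noteq> 0 \<Longrightarrow> lead_independent {0} f"
  by (erule ex_length) (auto simp: lead_independent_def near_zero lead_generated_zero)

text \<open>
  The case \<open>U = {0}\<close>: a free algebra is a domain.
\<close>

lemma free_algebra_mult_eq_0: 
  fixes f g :: "('g, bit) free_algebra"
  assumes "f * g = 0" shows "f = 0 \<or> g = 0"
  using lead_independent_mult_notin[OF zero_right_ideal lead_independent_zero_ideal] assms by auto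

section \<open>Enlarging a right ideal of \<open>\<F>\<^sub>2\<langle>x, z\<rangle>\<close>\<close>

text \<open>
  The subalgebra of \<open>R\<close> generated by \<open>x\<close> and \<open>z = 1 + ax\<close> is free on these two elements. Here it
  is introduced as a free algebra of its own; \<open>\<xi>\<close> and \<open>\<zeta>\<close> stand for \<open>x\<close> and \<open>z\<close>.
\<close>

datatype core_gen = Core_x | Core_z

type_synonym core = "(core_gen, bit) free_algebra"

abbreviation \<xi> :: core where "\<xi> \<equiv> gen Core_x"

abbreviation \<zeta> :: core where "\<zeta> \<equiv> gen Core_z"

definition enlarge :: "core set \<Rightarrow> core \<Rightarrow> core set" where
  "enlarge U h = {u + h * \<zeta> * s | u s. u \<in> U}"

lemma enlargeI: "u \<in> U \<Longrightarrow> u + h * \<zeta> * s \<in> enlarge U h"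
  by (auto simp: enlarge_def)

lemma subset_enlarge: "U \<subseteq> enlarge U h"
  using enlargeI[of _ U h 0] by auto

lemma mult_zeta_in_enlarge: "right_ideal U \<Longrightarrow> h * \<zeta> * s \<in> enlarge U h"
  using enlargeI[OF right_ideal_zero, of U h s] by auto

lemma right_ideal_enlarge:
  assumes U: "right_ideal U" shows "right_ideal (enlarge U h)"
  unfolding right_ideal_def
proof (intro conjI ballI allI)
  show "0 \<in> enlarge U h"
    using subset_enlarge right_ideal_zero[OF U] by blast
next
  fix v w t assume "v \<in> enlarge U h"
  then obtain u s where v: "v = u + h * \<zeta> * s" "u \<in> U" by (auto simp: enlarge_def)
  show "v * t \<in> enlarge U h"
    using enlargeI[OF right_ideal_mult[OF U v(2)], of t h "s * t"] by (simp add: v(1) algebra_simps)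
  assume "w \<in> enlarge U h"
  then obtain u' s' where w: "w = u' + h * \<zeta> * s'" "u' \<in> U" by (auto simp: enlarge_def)
  show "v + w \<in> enlarge U h"
    using enlargeI[OF right_ideal_add[OF U v(2) w(2)], of h "s + s'"] by (simp add: v(1) w(1) algebra_simps)
qed

lemma enlarge_cong:
  assumes U: "right_ideal U" and "f - g \<in> U" shows "enlarge U f = enlarge U g"
proof -
  have "enlarge U f \<subseteq> enlarge U g" if "f - g \<in> U" for f g :: core
  proof
    fix v assume "v \<in> enlarge U f"
    then obtain u s where v: "v = u + f * \<zeta> * s" "u \<in> U" by (auto simp: enlarge_def)
    have "u + (f - g) * (\<zeta> * s) \<in> U"
      by (intro right_ideal_add right_ideal_mult U v that)
    from enlargeI[OF this, of g s] show "v \<in> enlarge U g"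
      by (simp add: v(1) algebra_simps)
  qed
  moreover have "g - f \<in> U"
    using right_ideal_uminus[OF U assms(2)] by simp
  ultimately show ?thesis using assms(2) by blast
qed

lemma short_zeta: "short (Suc (Suc 0)) \<zeta>"
  by (simp add: right_deriv_gen)

text \<open>
  Throughout, \<open>h\<close> has length \<open>m\<close>, is shortest modulo \<open>U\<close>, and the leading forms
  of \<open>U\<close> are generated in lengths up to \<open>m\<close>.
\<close>

context
  fixes U :: "core set" and h m
  assumes U: "right_ideal U" and lead: "lead_generated U m"
    and h: "short (Suc m) h" "h \<notin> near U m"
begin

text \<open>
  By \<open>mult_notin_near\<close>, the leading form of \<open>h \<zeta> s\<close> cannot be cancelled by an element of \<open>U\<close>, so
  a bound on the length modulo \<open>U\<close> is a bound on the length of \<open>s\<close> itself.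
\<close>

lemma short_cofactor:
  assumes "h * \<zeta> * s \<in> near U (Suc m + j)" shows "short j s"
proof (rule ccontr)
  assume s: "\<not> short j s"
  then have "s \<noteq> 0" by auto
  then obtain k where k: "short (Suc k) s" "\<not> short k s" by (rule ex_length)
  have "j \<le> k"
    using short_mono[OF k(1), of j] s by (cases "j \<le> k") auto
  have "\<zeta> * s \<notin> near {0} (Suc 0 + k)"
    by (rule mult_notin_near[OF zero_right_ideal lead_generated_zero short_zeta _ k])
      (auto simp: near_zero right_deriv_gen)
  moreover have "short (Suc (Suc k)) (\<zeta> * s)"
    using short_mult[OF short_zeta k(1)] by simp
  ultimately have "h * (\<zeta> * s) \<notin> near U (m + Suc k)"
    by (intro mult_notin_near[OF U lead h]) (auto simp: near_zero)
  then show False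
    using assms near_mono[of "h * \<zeta> * s" U "Suc m + j" U "m + Suc k"] \<open>j \<le> k\<close>
    by (simp add: mult.assoc)
qed

lemma short_h_zeta: "short (Suc (Suc m)) (h * \<zeta>)"
  using h(1) by (simp add: right_deriv_mult_gen)

lemma short_h_zeta_mult: "short j s \<Longrightarrow> short (Suc m + j) (h * \<zeta> * s)"
  by (rule short_mult[OF short_h_zeta])

text \<open>
  In \<open>u + h \<zeta> s\<close> the leading forms of the two summands do not cancel, so both are as short as the
  sum. The condition for \<open>u\<close> is inherited from \<open>U\<close>, and the cofactors of \<open>h \<zeta> s\<close> are again multiples
  of \<open>h \<zeta>\<close>, except that the constant term of \<open>s\<close> exposes the letters of \<open>h \<zeta>\<close>, which has length
  \<open>m + 1\<close>.
\<close>

lemma lead_generated_enlarge: "lead_generated (enlarge U h) (Suc m)"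
  unfolding lead_generated_def
proof (intro ballI allI impI)
  fix v n l
  assume "v \<in> enlarge U h" and n: "Suc m \<le> n" and v_short: "short (Suc (Suc n)) v"
  then obtain u s where v: "v = u + h * \<zeta> * s" "u \<in> U" by (auto simp: enlarge_def)
  (* Then j bounds the length of s when h * z * s is as short as v. *)
  obtain j where j: "Suc (Suc n) = Suc m + j"
    using n by (metis le_Suc_ex le_SucI)
  have "h * \<zeta> * s \<in> near U (Suc m + j)"
  proof (rule nearI[OF right_ideal_uminus[OF U v(2)]])
    have "h * \<zeta> * s - - u = v" by (simp add: v(1))
    then show "short (Suc m + j) (h * \<zeta> * s - - u)"
      using v_short by (simp only: j)
  qed
  then have hZs: "short (Suc (Suc n)) (h * \<zeta> * s)"
    unfolding j by (intro short_h_zeta_mult short_cofactor)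
  have "short (Suc (Suc n)) u"
    using short_diff[OF v_short hZs] by (simp only: v(1) add_diff_cancel_right')
  then have "right_deriv l u \<in> near U n"
    using lead_generatedD[OF lead v(2)] n by simp
  then have 1: "right_deriv l u \<in> near (enlarge U h) n"
    by (rule near_mono[OF _ subset_enlarge]) simp
  have 2: "h * \<zeta> * right_deriv l s \<in> near (enlarge U h) n"
    by (intro mem_near mult_zeta_in_enlarge U)
  have "short n (right_deriv l (h * \<zeta>))"
    using short_mono[OF h(1) n] by (simp add: right_deriv_mult_gen)
  then have 3: "right_deriv l (h * \<zeta>) * aug s \<in> near (enlarge U h) n"
    by (intro short_near right_ideal_enlarge U short_mult_aug)
  show "right_deriv l v \<in> near (enlarge U h) n"
    unfolding v(1) right_deriv_add right_deriv_mult[of l "h * \<zeta>" s]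
    by (intro near_add right_ideal_enlarge U 1 2 3)
qed

text \<open>
  If \<open>f\<close> is no longer than \<open>h\<close>, then \<open>\<xi>\<close> occurs as a last letter in the leading form of the new
  element, with cofactor the leading form of \<open>h\<close>. An element of the enlarged ideal with the same
  leading form has the shape \<open>u + h \<zeta> c\<close> with \<open>c\<close> constant, so its cofactor of \<open>\<xi>\<close> comes from \<open>u\<close>,
  and \<open>h\<close> would not be shortest modulo \<open>U\<close>.
\<close>

lemma successor_if_short:
  assumes f: "short (Suc m) f"
  shows "short (Suc (Suc m)) (h * \<xi> + f * (1 + \<zeta>))" 
    and "h * \<xi> + f * (1 + \<zeta>) \<notin> near (enlarge U h) (Suc m)"
proof -
  let ?h' = "h * \<xi> + f * (1 + \<zeta>)"
  have h': "?h' = h * \<xi> + f + f * \<zeta>"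
    by (simp add: algebra_simps)
  have dx: "right_deriv Core_x ?h' = h + right_deriv Core_x f"
    unfolding h' by (simp add: right_deriv_add right_deriv_mult_gen)
  have "short (Suc m) (right_deriv l ?h')" for l
    unfolding h' right_deriv_add right_deriv_mult_gen
    by (intro short_add) (use f h short_Suc[OF short_right_deriv[OF f]] in \<open>auto simp del: short.simps\<close>)
  then show *: "short (Suc (Suc m)) ?h'" by simp
  show "?h' \<notin> near (enlarge U h) (Suc m)"
  proof
    assume "?h' \<in> near (enlarge U h) (Suc m)"
    then obtain u s where u: "u \<in> U" and d: "short (Suc m) (?h' - (u + h * \<zeta> * s))"
      by (auto elim!: nearE simp: enlarge_def)
    have d2: "short (Suc (Suc m)) (?h' - (?h' - (u + h * \<zeta> * s)))"
      by (intro short_diff * short_Suc[OF d])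
    then have v_short: "short (Suc (Suc m)) (u + h * \<zeta> * s)"
      by (simp only: diff_diff_eq2 diff_add_eq add_diff_cancel_left')
    then have "h * \<zeta> * s \<in> near U (Suc m + Suc 0)"
      by (intro nearI[OF right_ideal_uminus[OF U u]]) (simp add: add.commute)
    then have s: "short (Suc 0) s" by (rule short_cofactor)
    from short_h_zeta_mult[OF s] have "short (Suc (Suc m)) (h * \<zeta> * s)" by simp
    from short_diff[OF v_short this] have "short (Suc (Suc m)) u"
      by (simp only: add_diff_cancel_right')
    then have 1: "right_deriv Core_x u \<in> near U m"
      using lead_generatedD[OF lead u] by simp
    have "right_deriv Core_x (h * \<zeta> * s) = 0"
      using short_one_imp[OF s] by (auto simp: right_deriv_mult_gen)
    then have "right_deriv Core_x (?h' - (u + h * \<zeta> * s)) = h + right_deriv Core_x f - right_deriv Core_x u"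
      by (simp only: right_deriv_diff right_deriv_add[of _ u] dx add_0_right)
    with short_right_deriv[OF d, of Core_x]
    have "short m (h + right_deriv Core_x f - right_deriv Core_x u)" by simp
    then have 2: "h + right_deriv Core_x f - right_deriv Core_x u \<in> near U m"
      by (rule short_near[OF U])
    have 3: "right_deriv Core_x f \<in> near U m"
      using f by (intro short_near U) simp
    have "h + right_deriv Core_x f - right_deriv Core_x u + right_deriv Core_x u - right_deriv Core_x f \<in> near U m"
      by (intro near_add near_diff U 1 2 3)
    then show False
      using h(2) by simp
  qed
qed

text \<open>
  If \<open>f\<close> is longer than \<open>h\<close> and cannot be shortened modulo the enlarged ideal, then the leading
  form of the new element is that of \<open>f \<zeta>\<close>, and the cofactor of \<open>\<zeta>\<close> is the leading form of \<open>f\<close>.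
\<close>

lemma successor_if_long:
  assumes f: "short (Suc n) f" "f \<notin> near (enlarge U h) n" and n: "Suc m \<le> n"
  shows "short (Suc (Suc n)) (h * \<xi> + f * (1 + \<zeta>))" 
    and "h * \<xi> + f * (1 + \<zeta>) \<notin> near (enlarge U h) (Suc n)"
proof -
  let ?h' = "h * \<xi> + f * (1 + \<zeta>)" and ?V = "enlarge U h"
  have h': "?h' = h * \<xi> + f + f * \<zeta>"
    by (simp add: algebra_simps)
  have dz: "right_deriv Core_z ?h' = right_deriv Core_z f + f"
    unfolding h' by (simp add: right_deriv_add right_deriv_mult_gen)
  have "short (Suc n) h"
    by (rule short_mono[OF h(1)]) (use n in simp)
  then have "short (Suc n) (right_deriv l ?h')" for l
    unfolding h' right_deriv_add right_deriv_mult_gen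
    by (intro short_add) (use f(1) short_Suc[OF short_right_deriv[OF f(1)]] in \<open>auto simp del: short.simps\<close>)
  then show *: "short (Suc (Suc n)) ?h'" by simp
  show "?h' \<notin> near ?V (Suc n)"
  proof
    assume "?h' \<in> near ?V (Suc n)"
    then obtain v where v: "v \<in> ?V" and d: "short (Suc n) (?h' - v)"
      by (rule nearE)
    have "short (Suc (Suc n)) (?h' - (?h' - v))"
      by (intro short_diff * short_Suc[OF d])
    then have "short (Suc (Suc n)) v" by (simp only: diff_diff_eq2 diff_add_eq add_diff_cancel_left')
    then have 1: "right_deriv Core_z v \<in> near ?V n"
      using lead_generatedD[OF lead_generated_enlarge v n] by simp
    have "short n (right_deriv Core_z f + f - right_deriv Core_z v)"
      using short_right_deriv[OF d, of Core_z] by (simp only: right_deriv_diff dz)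
    then have 2: "right_deriv Core_z f + f - right_deriv Core_z v \<in> near ?V n"
      by (intro short_near right_ideal_enlarge U)
    have 3: "right_deriv Core_z f \<in> near ?V n"
      using f(1) by (intro short_near right_ideal_enlarge U) simp
    have "right_deriv Core_z f + f - right_deriv Core_z v + right_deriv Core_z v - right_deriv Core_z f \<in> near ?V n"
      by (intro near_add near_diff right_ideal_enlarge U 1 2 3)
    then show False
      using f(2) by simp
  qed
qed

end

text \<open>
  The element \<open>f\<close> may be replaced by a shortest one modulo \<open>enlarge U g\<close>, because this changes
  \<open>f * (1 + \<zeta>)\<close> only by an element of that right ideal. Then one of the two preceding lemmas
  applies.
\<close>

lemma lead_independent_enlarge:
  assumes U: "right_ideal U" and "lead_independent U g"
  shows "lead_independent (enlarge U g) (g * \<xi> + f * (1 + \<zeta>))"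
proof -
  obtain m h where gh: "g - h \<in> U" and h: "short (Suc m) h" "h \<notin> near U m"
    and lead: "lead_generated U m"
    using assms by (auto simp: lead_independent_def)
  define V where "V = enlarge U h"
  have V: "right_ideal V" and UV: "U \<subseteq> V"
    by (simp_all add: V_def right_ideal_enlarge U subset_enlarge)
  have enl: "enlarge U g = V"
    using enlarge_cong[OF U gh] by (simp add: V_def)
  have leadV: "lead_generated V (Suc m)"
    unfolding V_def by (rule lead_generated_enlarge[OF U lead h])
  define N where "N = (LEAST n. f \<in> near V n)"
  have "f \<in> near V N"
    unfolding N_def using ex_short[of f] short_near[OF V] by (metis LeastI_ex)
  then obtain v where v: "v \<in> V" "short N (f - v)" by (rule nearE)
  define f' where "f' = f - v"
  let ?h' = "h * \<xi> + f' * (1 + \<zeta>)"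
  have "g * \<xi> + f * (1 + \<zeta>) - ?h' = (g - h) * \<xi> + v * (1 + \<zeta>)"
    by (simp add: f'_def algebra_simps)
  also have "\<dots> \<in> V"
    using gh UV by (intro right_ideal_add right_ideal_mult V v) auto
  finally have eq: "g * \<xi> + f * (1 + \<zeta>) - ?h' \<in> V" .
  show ?thesis
  proof (cases "N \<le> Suc m")
    case True
    then have "short (Suc m) f'"
      unfolding f'_def by (rule short_mono[OF v(2)])
    from successor_if_short[OF U lead h this] show ?thesis
      unfolding enl lead_independent_def V_def[symmetric] using eq leadV by blast
  next
    case False
    then obtain n where n: "N = Suc n" "Suc m \<le> n" by (cases N) auto
    have "f \<notin> near V n"
      using not_less_Least[of n "\<lambda>n. f \<in> near V n"] n by (simp add: N_def)
    then have "f' \<notin> near V n"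
      using near_add[OF V _ mem_near[OF v(1)], of f' n] by (auto simp: f'_def)
    then have "short (Suc (Suc n)) ?h'" "?h' \<notin> near V (Suc n)"
      using successor_if_long[OF U lead h, of n f'] v n by (auto simp: f'_def V_def)
    moreover have "lead_generated V (Suc n)"
      using lead_generated_mono[OF leadV] n by simp
    ultimately show ?thesis
      unfolding enl lead_independent_def using eq by blast
  qed
qed

section \<open>Actions of free algebras\<close>

text \<open>
  The right action of a free algebra in which a letter \<open>l\<close> acts by \<open>step l\<close>. Coefficients are bits,
  so an element is determined by its set of words.
\<close>

definition word_action :: "('g \<Rightarrow> 'v \<Rightarrow> 'v::ab_group_add) \<Rightarrow> 'v \<Rightarrow> ('g, bit) free_algebra \<Rightarrow> 'v" where
  "word_action step v f = (\<Sum>w\<in>Poly_Mapping.keys f. fold step (letters w) v)"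

locale char_2_action =
  fixes step :: "'g \<Rightarrow> 'v \<Rightarrow> 'v::ab_group_add"
  assumes step_add: "step l (u + v) = step l u + step l v"
    and char_2: "(v::'v) + v = 0"
begin

abbreviation act :: "'v \<Rightarrow> ('g, bit) free_algebra \<Rightarrow> 'v" where
  "act \<equiv> word_action step"

lemma act_superset:
  assumes "finite A" "Poly_Mapping.keys f \<subseteq> A"
  shows "act v f = (\<Sum>w\<in>A. if w \<in> Poly_Mapping.keys f then fold step (letters w) v else 0)"
  unfolding word_action_def by (rule sum.mono_neutral_cong_left) (use assms in auto)

lemma act_add: "act v (f + g) = act v f + act v g"
proof -
  let ?A = "Poly_Mapping.keys f \<union> Poly_Mapping.keys g"
  have "(if w \<in> Poly_Mapping.keys (f + g) then fold step (letters w) v else 0) =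
      (if w \<in> Poly_Mapping.keys f then fold step (letters w) v else 0) +
      (if w \<in> Poly_Mapping.keys g then fold step (letters w) v else 0)" for w
    by (cases "Poly_Mapping.lookup f w"; cases "Poly_Mapping.lookup g w")
      (simp_all add: in_keys_iff lookup_add char_2)
  then show ?thesis
    using act_superset[of ?A "f + g" v] act_superset[of ?A f v] act_superset[of ?A g v] keys_add[of f g]
    by (simp add: sum.distrib)
qed

lemma act_zero: "act v 0 = 0"
  by (simp add: word_action_def)

lemma act_one: "act v 1 = v"
  by (simp add: word_action_def zero_free_monoid_def)

lemma act_gen_mult: "act v (gen l * f) = act (step l v) f"
proof (induction f rule: free_algebra_word_induct)
  case (word w)
  show ?case
    unfolding single_Cons[symmetric] by (simp add: word_action_def)
qed (simp_all add: act_add act_zero distrib_left)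

lemma act_gen: "act v (gen l) = step l v"
  using act_gen_mult[of v l 1] by (simp add: act_one)

lemma act_add_vector: "act (u + v) f = act u f + act v f"
  by (induction f arbitrary: u v rule: free_algebra_Cons_induct)
    (simp_all add: act_zero act_one act_gen_mult step_add act_add ac_simps)

lemma act_zero_vector: "act 0 f = 0"
  using act_add_vector[of 0 0 f] by simp

lemma act_mult: "act v (f * g) = act (act v f) g"
  by (induction f arbitrary: v rule: free_algebra_Cons_induct)
    (simp_all add: act_zero act_one act_gen_mult mult.assoc act_add distrib_right act_add_vector
      act_zero_vector)

end


section \<open>The normal form module\<close>

abbreviation alpha :: "(generator, bit) free_algebra" ("\<alpha>") where "\<alpha> \<equiv> gen Gen_a"

abbreviation chi :: "(generator, bit) free_algebra" ("\<chi>") where "\<chi> \<equiv> gen Gen_x"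

text \<open>
  Right multiplication by \<open>x\<close> and by \<open>z = 1 + ax\<close>. The corresponding action, applied to 1, is
  the algebra homomorphism \<open>embed\<close>.
\<close>

primrec embed_step :: "core_gen \<Rightarrow> (generator, bit) free_algebra \<Rightarrow> (generator, bit) free_algebra" where
  "embed_step Core_x f = f * \<chi>"
| "embed_step Core_z f = f * (1 + \<alpha> * \<chi>)"

interpretation embed: char_2_action embed_step
proof
  show "embed_step l (f + g) = embed_step l f + embed_step l g" for l f g
    by (cases l) (simp_all add: distrib_right)
qed simp

definition embed :: "core \<Rightarrow> (generator, bit) free_algebra" where
  "embed = word_action embed_step 1"

lemma embed_zero [simp]: "embed 0 = 0" and embed_one [simp]: "embed 1 = 1"
  and embed_add: "embed (s + t) = embed s + embed t"
  by (simp_all add: embed_def embed.act_zero embed.act_one embed.act_add)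

lemma embed_x: "embed \<xi> = \<chi>" and embed_z: "embed \<zeta> = 1 + \<alpha> * \<chi>"
  by (simp_all add: embed_def embed.act_gen)

lemma embed_action: "word_action embed_step f t = f * embed t"
proof (induction t arbitrary: f rule: free_algebra_Cons_induct)
  case (Cons t l)
  have "embed_step l f = f * embed_step l 1"
    by (cases l) simp_all
  then show ?case
    using Cons[of "embed_step l f"] Cons[of "embed_step l 1"]
    by (simp add: embed.act_gen_mult embed_def mult.assoc)
qed (simp_all add: embed.act_zero embed.act_one embed.act_add embed_add distrib_left)

lemma embed_mult: "embed (s * t) = embed s * embed t"
  unfolding embed_def embed.act_mult by (simp only: embed_action embed_def[symmetric])

text \<open>
  Right multiplication by \<open>a\<close> and by \<open>x\<close> on \<open>\<Sum>i. t\<^sub>i a\<^sup>i\<close>, where the polynomial has the coefficients \<open>t\<^sub>i\<close>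
  from \<open>\<F>\<^sub>2\<langle>x, z\<rangle>\<close>. It encodes \<open>a x = 1 + z\<close> and \<open>a\<^sup>i x = a\<^bsup>i - 1\<^esup>\<close> for \<open>i \<ge> 2\<close>.
\<close>

primrec nf_step :: "generator \<Rightarrow> core poly \<Rightarrow> core poly" where
  "nf_step Gen_a m = pCons 0 m"
| "nf_step Gen_x m = pCons (poly.coeff m 0 * \<xi> + poly.coeff m 1 * (1 + \<zeta>)) (poly_shift 2 m)"

interpretation nf: char_2_action nf_step
proof
  show "nf_step l (u + v) = nf_step l u + nf_step l v" for l u v
    by (cases l) (auto simp: poly_eq_iff coeff_pCons coeff_poly_shift algebra_simps split: nat.split)
  show "v + v = 0" for v :: "core poly"
    by (simp add: poly_eq_iff)
qed

abbreviation nf_act :: "core poly \<Rightarrow> (generator, bit) free_algebra \<Rightarrow> core poly" where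
  "nf_act \<equiv> word_action nf_step"

text \<open>
  The normal form of \<open>f\<close> is \<open>1 \<cdot> f\<close> in this module.
\<close>

definition nf :: "(generator, bit) free_algebra \<Rightarrow> core poly" where
  "nf f = nf_act [:1:] f"

text \<open>
  This is \<open>a z = 0\<close>: only the constant coefficient survives right multiplication by \<open>z\<close>.
\<close>

lemma nf_act_embed_z: "nf_act m (embed \<zeta>) = [:poly.coeff m 0 * \<zeta>:]"
proof -
  have "nf_act m (embed \<zeta>) = m + nf_step Gen_x (nf_step Gen_a m)"
    by (simp add: embed_z nf.act_add nf.act_one nf.act_gen_mult nf.act_gen del: nf_step.simps)
  also have "\<dots> = [:poly.coeff m 0 * \<zeta>:]"
    by (rule poly_eqI)
      (simp add: coeff_pCons coeff_poly_shift distrib_left flip: add.assoc split: nat.split)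
  finally show ?thesis .
qed

lemma nf_act_embed_x_mult: "nf_act m (embed (\<xi> * t)) = nf_act (nf_step Gen_x m) (embed t)"
  by (simp add: embed_mult embed_x nf.act_gen_mult)

lemma nf_act_embed_z_mult: "nf_act m (embed (\<zeta> * t)) = nf_act [:poly.coeff m 0 * \<zeta>:] (embed t)"
  by (simp add: embed_mult nf.act_mult nf_act_embed_z)

lemma nf_act_const_embed: "nf_act [:s:] (embed t) = [:s * t:]"
proof (induction t arbitrary: s rule: free_algebra_Cons_induct)
  case (Cons t l)
  then show ?case
    by (cases l)
      (simp_all add: nf_act_embed_x_mult nf_act_embed_z_mult coeff_pCons mult.assoc poly_shift_def
        flip: zero_poly.abs_eq)
qed (simp_all add: nf.act_zero nf.act_one embed_add nf.act_add distrib_left)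

lemma nf_embed: "nf (embed t) = [:t:]"
  by (simp add: nf_def nf_act_const_embed)

lemma coeff_nf_step_x:
  assumes "\<And>i. i > Suc n \<Longrightarrow> poly.coeff m i = 0" "i > n"
  shows "poly.coeff (nf_step Gen_x m) i = 0"
  using assms by (cases i) (simp_all add: coeff_poly_shift)

text \<open>
  Right multiplication by elements of \<open>\<F>\<^sub>2\<langle>x, z\<rangle>\<close> does not raise the degree in \<open>a\<close>, since \<open>x\<close> lowers
  it and \<open>z\<close> leaves only the constant coefficient.
\<close>

lemma coeff_nf_act_embed:
  assumes "\<And>i. i > n \<Longrightarrow> poly.coeff m i = 0" "i > n"
  shows "poly.coeff (nf_act m (embed t)) i = 0"
  using assms
proof (induction t arbitrary: m i rule: free_algebra_Cons_induct)
  case (Cons t l)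
  show ?case
  proof (cases l)
    case Core_x
    show ?thesis
      unfolding Core_x nf_act_embed_x_mult
      by (rule Cons.IH[OF coeff_nf_step_x]) (use Cons.prems in auto)
  next
    case Core_z
    show ?thesis
      unfolding Core_z nf_act_embed_z_mult nf_act_const_embed
      using Cons.prems by (cases i) simp_all
  qed
qed (simp_all add: nf.act_zero nf.act_one embed_add nf.act_add)

lemma core_left_decomposition:
  fixes t :: core
  obtains c p q where "c = 0 \<or> c = 1" "t = c + \<xi> * p + \<zeta> * q"
proof -
  have "\<exists>c p q. (c = 0 \<or> c = 1) \<and> t = c + \<xi> * p + \<zeta> * q"
  proof (induction t rule: free_algebra_Cons_induct)
    case zero
    show ?case by (intro exI[of _ 0]) simp
  next
    case one
    show ?case by (intro exI[of _ 1] exI[of _ 0]) simp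
  next
    case (Cons t l)
    show ?case
    proof (cases l)
      case Core_x
      then show ?thesis by (intro exI[of _ 0] exI[of _ t]) simp
    next
      case Core_z
      then have "gen l * t = 0 + \<xi> * 0 + \<zeta> * t" by simp
      then show ?thesis by blast
    qed
  next
    case (add s t)
    then obtain c p q c' p' q' where c: "c = 0 \<or> c = 1" "c' = 0 \<or> c' = 1"
      and st: "s = c + \<xi> * p + \<zeta> * q" "t = c' + \<xi> * p' + \<zeta> * q'"
      by blast
    have "s + t = (c + c') + \<xi> * (p + p') + \<zeta> * (q + q')"
      by (simp add: st algebra_simps)
    moreover have "c + c' = 0 \<or> c + c' = 1"
      using c by auto
    ultimately show ?case by blast
  qed
  then show thesis using that by blast
qed

text \<open>
  The heart of the proof, by induction on the degree in \<open>a\<close>. Write \<open>t = c + x p + z q\<close>. If \<open>m\<close> has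
  positive degree, then the leading coefficient of \<open>m \<cdot> t\<close> is \<open>c\<close> times that of \<open>m\<close>, because \<open>m \<cdot> x\<close> has
  smaller degree and \<open>m \<cdot> z\<close> is constant. Hence \<open>c = 0\<close>, and \<open>(m \<cdot> x) \<cdot> p\<close> lies in \<open>U + h z T\<close>, where
  \<open>h\<close> is the constant coefficient of \<open>m\<close> and \<open>T = \<F>\<^sub>2\<langle>x, z\<rangle>\<close>. By \<open>lead_independent_enlarge\<close> the
  induction hypothesis applies to \<open>m \<cdot> x\<close>.
\<close>

lemma nf_act_embed_in_ideal_imp_zero:
  assumes "\<And>i. i > n \<Longrightarrow> poly.coeff m i = 0"
    and "right_ideal U" "lead_independent U (poly.coeff m 0)"
    and "nf_act m (embed t) = [:v:]" "v \<in> U"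
  shows "t = 0"
  using assms
proof (induction n arbitrary: m U t v)
  case 0
  then have "m = [:poly.coeff m 0:]"
    by (intro poly_eqI) (simp add: coeff_pCons split: nat.split)
  then have "[:v:] = [:poly.coeff m 0 * t:]"
    using 0 nf_act_const_embed by metis
  then have "poly.coeff m 0 * t \<in> U"
    using 0 by simp
  then show ?case
    using lead_independent_mult_notin 0 by blast
next
  case (Suc n)
  note U = \<open>right_ideal U\<close>
  show ?case
  proof (cases "poly.coeff m (Suc n) = 0")
    case True
    then have "poly.coeff m i = 0" if "i > n" for i
      using Suc.prems(1)[of i] that by (cases "i = Suc n") auto
    then show ?thesis
      using Suc.IH Suc.prems by blast
  next
    case False
    obtain c p q where c: "c = 0 \<or> c = 1" and t: "t = c + \<xi> * p + \<zeta> * q"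
      by (rule core_left_decomposition)
    let ?h = "poly.coeff m 0"
    have act: "[:v:] = nf_act m (embed c) + nf_act (nf_step Gen_x m) (embed p) + [:?h * \<zeta> * q:]"
      using Suc.prems(4)
      by (simp only: t embed_add nf.act_add nf_act_embed_x_mult nf_act_embed_z_mult nf_act_const_embed)
    have small: "poly.coeff (nf_step Gen_x m) i = 0" if "i > n" for i
      using coeff_nf_step_x[OF Suc.prems(1) that] .
    have "poly.coeff (nf_act m (embed c)) (Suc n) = 0"
      using arg_cong[OF act, of "\<lambda>m. poly.coeff m (Suc n)"] coeff_nf_act_embed[OF small]
      by (simp del: nf_step.simps)
    with c False have "c = 0"
      by (auto simp: nf.act_one)
    have act': "[:v:] = nf_act (nf_step Gen_x m) (embed p) + [:?h * \<zeta> * q:]"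
      using act by (simp add: \<open>c = 0\<close> nf.act_zero del: nf_step.simps)
    have "nf_act (nf_step Gen_x m) (embed p) = [:v:] - [:?h * \<zeta> * q:]"
      unfolding act' by (rule add_diff_cancel_right'[symmetric])
    then have "nf_act (nf_step Gen_x m) (embed p) = [:v - ?h * \<zeta> * q:]" by simp
    moreover have "v - ?h * \<zeta> * q \<in> enlarge U ?h"
      using Suc.prems(5) subset_enlarge
      by (intro right_ideal_diff right_ideal_enlarge U mult_zeta_in_enlarge) auto
    moreover have "lead_independent (enlarge U ?h) (poly.coeff (nf_step Gen_x m) 0)"
      using lead_independent_enlarge[OF U Suc.prems(3)] by simp
    ultimately have p: "p = 0"
      using Suc.IH[OF small right_ideal_enlarge[OF U]] by blast
    then have "?h * (\<zeta> * q) \<in> U"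
      using act Suc.prems(5) \<open>c = 0\<close> by (simp add: nf.act_zero mult.assoc)
    then have "\<zeta> * q = 0"
      using lead_independent_mult_notin[OF U Suc.prems(3)] by blast
    with p \<open>c = 0\<close> show ?thesis by (simp add: t)
  qed
qed

text \<open>
  Right multiplication by \<open>x\<close> is injective: if \<open>t \<noteq> 0\<close>, then the leading form of \<open>t \<zeta>\<close> cannot be cancelled
  in \<open>s \<xi> + t + t \<zeta>\<close>.
\<close>

lemma nf_step_x_eq_0:
  assumes "nf_step Gen_x m = 0" shows "m = 0"
proof -
  let ?s = "poly.coeff m 0" and ?t = "poly.coeff m 1"
  have st: "?s * \<xi> + ?t * (1 + \<zeta>) = 0"
    using arg_cong[OF assms, of "\<lambda>m. poly.coeff m 0"] by simp
  have t: "?t = 0"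
  proof (rule ccontr)
    assume "?t \<noteq> 0"
    then obtain k where k: "short (Suc k) ?t" "\<not> short k ?t" by (rule ex_length)
    have "right_deriv Core_z (?s * \<xi> + (?t + ?t * \<zeta>)) = 0"
      using st by (simp add: distrib_left)
    then have "right_deriv Core_z ?t + ?t = 0"
      by (simp add: right_deriv_add right_deriv_mult_gen)
    then have "right_deriv Core_z ?t = ?t"
      using free_algebra_minus_eq_plus[of "right_deriv Core_z ?t" ?t] by simp
    then show False
      using short_right_deriv[OF k(1), of Core_z] k(2) by simp
  qed
  have s: "?s = 0"
    using st t free_algebra_mult_eq_0[of ?s \<xi>] right_deriv_gen[of Core_x Core_x] by auto
  have "poly.coeff m i = 0" for i
  proof (cases "i < 2")
    case True
    then have "i = 0 \<or> i = 1" by auto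
    then show ?thesis using s t by auto
  next
    case False
    then obtain j where "i = Suc (Suc j)" by (metis add_2_eq_Suc le_Suc_ex linorder_not_less)
    then show ?thesis
      using arg_cong[OF assms, of "\<lambda>m. poly.coeff m (Suc j)"] by (simp add: coeff_poly_shift)
  qed
  then show ?thesis by (simp add: poly_eq_iff)
qed

text \<open>
  The element \<open>\<Sum>i. t\<^sub>i a\<^sup>i\<close> of the free algebra on \<open>a\<close> and \<open>x\<close>.
\<close>

definition from_nf :: "core poly \<Rightarrow> (generator, bit) free_algebra" where
  "from_nf m = fold_coeffs (\<lambda>t f. embed t + f * \<alpha>) m 0"

lemma from_nf_pCons: "from_nf (pCons t m) = embed t + from_nf m * \<alpha>"
  by (cases "t = 0 \<and> m = 0") (auto simp: from_nf_def)

lemma from_nf_zero [simp]: "from_nf 0 = 0"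
  by (simp add: from_nf_def)

lemma from_nf_add: "from_nf (m + n) = from_nf m + from_nf n"
  by (induction m n rule: poly_induct2) (simp_all add: from_nf_pCons embed_add algebra_simps)

lemma nf_mult: "nf (f * g) = nf_act (nf f) g"
  by (simp add: nf_def nf.act_mult)

lemma nf_from_nf: "nf (from_nf m) = m"
proof (induction m)
  case 0
  show ?case by (simp add: nf_def nf.act_zero)
next
  case (pCons t m)
  have "nf (from_nf (pCons t m)) = nf (embed t) + nf_act (nf (from_nf m)) \<alpha>"
    by (simp add: from_nf_pCons nf_def nf.act_add nf.act_mult)
  then show ?case
    by (simp add: nf_embed pCons nf.act_gen)
qed

section \<open>Zero-divisors modulo the relation\<close>

definition relation_ideal :: "(generator, bit) free_algebra set" where
  "relation_ideal = Idl\<^bsub>F2_free\<^esub> {relator}"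

lemma relation_ideal_ideal: "ideal relation_ideal F2_free"
  unfolding relation_ideal_def
  by (rule ring.genideal_ideal[OF ring_ring_of_type_algebra]) (simp add: ring_of_type_algebra_def)

lemmas relation_ideal_subgroup = ideal.axioms(1)[OF relation_ideal_ideal]

lemma F2_free_simps [simp]:
  "carrier F2_free = UNIV" "f \<otimes>\<^bsub>F2_free\<^esub> g = f * g" "f \<oplus>\<^bsub>F2_free\<^esub> g = f + g"
  "\<zero>\<^bsub>F2_free\<^esub> = 0" "\<one>\<^bsub>F2_free\<^esub> = 1"
  by (simp_all add: ring_of_type_algebra_def)

lemma relation_ideal_zero: "0 \<in> relation_ideal"
  using additive_subgroup.zero_closed[OF relation_ideal_subgroup] by simp

lemma relation_ideal_add: "f \<in> relation_ideal \<Longrightarrow> g \<in> relation_ideal \<Longrightarrow> f + g \<in> relation_ideal"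
  using additive_subgroup.a_closed[OF relation_ideal_subgroup, of f g] by simp

lemma relation_ideal_mult_left: "f \<in> relation_ideal \<Longrightarrow> g * f \<in> relation_ideal"
  using ideal.I_l_closed[OF relation_ideal_ideal, of f g] by simp

lemma relation_ideal_mult_right: "f \<in> relation_ideal \<Longrightarrow> f * g \<in> relation_ideal"
  using ideal.I_r_closed[OF relation_ideal_ideal, of f g] by simp

lemma relator_in_relation_ideal: "relator \<in> relation_ideal"
  unfolding relation_ideal_def
  by (rule ring.genideal_self'[OF ring_ring_of_type_algebra]) (simp add: ring_of_type_algebra_def)

lemma relator_eq: "relator = \<alpha> + \<alpha> * \<alpha> * \<chi>"
  by (simp add: relator_def free_algebra_minus_eq_plus power2_eq_square)

lemma relation_ideal_minimal:
  assumes "relator \<in> K" and "0 \<in> K" and "\<And>f g. f \<in> K \<Longrightarrow> g \<in> K \<Longrightarrow> f + g \<in> K"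
    and "\<And>f g. f \<in> K \<Longrightarrow> g * f \<in> K" "\<And>f g. f \<in> K \<Longrightarrow> f * g \<in> K"
  shows "relation_ideal \<subseteq> K"
proof -
  have "ideal K F2_free"
  proof (rule idealI[OF ring_ring_of_type_algebra])
    have "inv\<^bsub>add_monoid F2_free\<^esub> f = f" for f
      using abelian_group.minus_equality[OF ring.is_abelian_group[OF ring_ring_of_type_algebra], of f f]
      by (simp add: a_inv_def)
    then show "subgroup K (add_monoid F2_free)"
      by (intro subgroup.intro) (use assms in auto)
  qed (use assms in auto)
  then show ?thesis
    unfolding relation_ideal_def
    by (rule ring.genideal_minimal[OF ring_ring_of_type_algebra]) (use assms in simp)
qed

text \<open>
  The annihilator of the module is a two-sided ideal, and it contains the relator.
\<close>

lemma nf_act_relation_ideal: 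
  assumes "f \<in> relation_ideal" shows "nf_act m f = 0"
proof -
  have "relation_ideal \<subseteq> {f. \<forall>m. nf_act m f = 0}"
  proof (rule relation_ideal_minimal)
    have "nf_act m relator = pCons 0 m + pCons 0 (poly_shift 2 (pCons 0 (pCons 0 m)))" for m
      by (simp add: relator_eq nf.act_add nf.act_gen nf.act_gen_mult mult.assoc)
    moreover have "poly_shift 2 (pCons 0 (pCons 0 m)) = m" for m :: "core poly"
      by (simp add: poly_eq_iff coeff_poly_shift)
    ultimately show "relator \<in> {f. \<forall>m. nf_act m f = 0}"
      by (simp add: nf.char_2)
  qed (auto simp: nf.act_zero nf.act_add nf.act_mult nf.act_zero_vector)
  then show ?thesis using assms by blast
qed

text \<open>
  Sums play the role of differences in characteristic 2: modulo the relation, \<open>from_nf\<close> is a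
  homomorphism of right modules.
\<close>

lemma from_nf_act: "from_nf (nf_act m f) + from_nf m * f \<in> relation_ideal"
proof (induction f arbitrary: m rule: free_algebra_Cons_induct)
  case zero
  show ?case by (simp add: nf.act_zero relation_ideal_zero)
next
  case one
  show ?case by (simp add: nf.act_one relation_ideal_zero)
next
  case (add f g)
  from relation_ideal_add[OF add(1)[of m] add(2)[of m]] show ?case
    by (simp add: nf.act_add from_nf_add algebra_simps)
next
  case (Cons f l)
  have step: "from_nf (nf_step l m) + from_nf m * gen l \<in> relation_ideal"
  proof (cases l)
    case Gen_a
    then show ?thesis by (simp add: from_nf_pCons relation_ideal_zero)
  next
    case Gen_x
    obtain s t n where m: "m = pCons s (pCons t n)"
      by (metis pCons_cases)
    have "poly_shift 2 m = n"
      by (simp add: m poly_eq_iff coeff_poly_shift)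
    then have "from_nf (nf_step l m) = embed (s * \<xi> + t * (1 + \<zeta>)) + from_nf n * \<alpha>"
      by (simp add: Gen_x m from_nf_pCons)
    also have "\<dots> = embed s * \<chi> + embed t * (1 + (1 + \<alpha> * \<chi>)) + from_nf n * \<alpha>"
      by (simp only: embed_add embed_mult embed_x embed_z embed_one)
    (* Two ones cancel, so that 1 + z becomes a * x. *)
    also have "\<dots> = embed s * \<chi> + embed t * \<alpha> * \<chi> + from_nf n * \<alpha>"
      by (simp flip: add.assoc add: mult.assoc)
    finally have 1: "from_nf (nf_step l m) = \<dots>" .
    have "from_nf m * gen l = embed s * \<chi> + embed t * \<alpha> * \<chi> + from_nf n * \<alpha> * \<alpha> * \<chi>"
      by (simp add: Gen_x m from_nf_pCons algebra_simps)
    with 1 have "from_nf (nf_step l m) + from_nf m * gen l =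
        (embed s * \<chi> + embed t * \<alpha> * \<chi> + (embed s * \<chi> + embed t * \<alpha> * \<chi>)) + from_nf n * relator"
      unfolding relator_eq by (simp only: distrib_left mult.assoc ac_simps)
    then show ?thesis
      using relation_ideal_mult_left[OF relator_in_relation_ideal] by simp
  qed
  have "from_nf (nf_act m (gen l * f)) + from_nf m * (gen l * f) =
      (from_nf (nf_act (nf_step l m) f) + from_nf (nf_step l m) * f) +
      (from_nf (nf_step l m) + from_nf m * gen l) * f"
  proof -
    have "from_nf (nf_step l m) * f + (from_nf (nf_step l m) * f + c) = c" for c
      by (simp flip: add.assoc)
    then show ?thesis
      by (simp only: nf.act_gen_mult distrib_right mult.assoc add.assoc)
  qed
  then show ?case
    using relation_ideal_add[OF Cons relation_ideal_mult_right[OF step]] by simp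
qed

lemma from_nf_nf: "from_nf (nf f) + f \<in> relation_ideal"
  using from_nf_act[of "[:1:]" f] by (simp add: nf_def from_nf_pCons)

lemma add_in_relation_idealD:
  assumes "f + g \<in> relation_ideal" "f \<in> relation_ideal" shows "g \<in> relation_ideal"
  using relation_ideal_add[OF assms(2,1)] by (simp flip: add.assoc)

text \<open>
  Hence \<open>R\<close> is isomorphic to the normal form module.
\<close>

lemma nf_eq_0_iff: "nf f = 0 \<longleftrightarrow> f \<in> relation_ideal"
proof
  assume "nf f = 0"
  then show "f \<in> relation_ideal" using from_nf_nf[of f] by simp
next
  assume "f \<in> relation_ideal"
  then show "nf f = 0" by (simp add: nf_def nf_act_relation_ideal)
qed

text \<open>
  Multiplying by \<open>x\<close> often enough removes all powers of \<open>a\<close> from the normal form, without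
  making it zero.
\<close>

lemma ex_mult_chi_power:
  assumes "g \<notin> relation_ideal"
  obtains k t where "nf (g * \<chi> ^ k) = [:t:]" "t \<noteq> 0"
proof -
  have "\<exists>k t. nf_act m (\<chi> ^ k) = [:t:] \<and> t \<noteq> 0" if "m \<noteq> 0" "\<And>i. i > n \<Longrightarrow> poly.coeff m i = 0" for m n
    using that
  proof (induction n arbitrary: m)
    case 0
    then have m: "m = [:poly.coeff m 0:]"
      by (intro poly_eqI) (simp add: coeff_pCons split: nat.split)
    with 0 have "poly.coeff m 0 \<noteq> 0"
      by (metis pCons_0_0)
    with m show ?case
      by (intro exI[of _ 0] exI[of _ "poly.coeff m 0"]) (simp add: nf.act_one)
  next
    case (Suc n)
    have "nf_step Gen_x m \<noteq> 0"
      using nf_step_x_eq_0 Suc.prems(1) by blast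
    then obtain k t where "nf_act (nf_step Gen_x m) (\<chi> ^ k) = [:t:]" "t \<noteq> 0"
      using Suc.IH[of "nf_step Gen_x m"] coeff_nf_step_x[OF Suc.prems(2)] by blast
    then show ?case
      by (intro exI[of _ "Suc k"] exI[of _ t]) (simp add: nf.act_gen_mult del: nf_step.simps)
  qed
  from this[of "nf g" "Polynomial.degree (nf g)"] show thesis
    using that assms by (auto simp: nf_eq_0_iff nf_mult coeff_eq_0)
qed

text \<open>
  In \<open>R\<close>, if \<open>f g = 0\<close> and \<open>g \<noteq> 0\<close>, then \<open>f \<in> R a\<close>. By \<open>ex_mult_chi_power\<close> it is enough to treat \<open>g\<close>
  in \<open>\<F>\<^sub>2\<langle>x, z\<rangle>\<close>. If the constant coefficient of the normal form of \<open>f\<close> were nonzero, then the main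
  induction, started at \<open>U = {0}\<close>, would give \<open>g = 0\<close>.
\<close>

lemma coeff_nf_eq_0_if_left_zero_divisor:
  assumes fg: "f * g \<in> relation_ideal" and g: "g \<notin> relation_ideal"
  shows "poly.coeff (nf f) 0 = 0"
proof (rule ccontr)
  assume *: "poly.coeff (nf f) 0 \<noteq> 0"
  obtain k t where t: "nf (g * \<chi> ^ k) = [:t:]" "t \<noteq> 0"
    using ex_mult_chi_power[OF g] .
  have "embed t + g * \<chi> ^ k \<in> relation_ideal"
    using from_nf_nf[of "g * \<chi> ^ k"] by (simp add: t(1) from_nf_pCons)
  from relation_ideal_mult_left[OF this, of f]
  have "f * g * \<chi> ^ k + f * embed t \<in> relation_ideal"
    by (simp add: algebra_simps)
  then have "f * embed t \<in> relation_ideal"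
    using relation_ideal_mult_right[OF fg] by (rule add_in_relation_idealD)
  then have "nf_act (nf f) (embed t) = [:0:]"
    by (simp add: nf_eq_0_iff flip: nf_mult)
  then have "t = 0"
    using nf_act_embed_in_ideal_imp_zero[OF _ zero_right_ideal lead_independent_zero_ideal[OF *]] coeff_eq_0 by blast
  with t(2) show False by simp
qed

lemma left_zero_divisor_annihilates:
  assumes "f * g \<in> relation_ideal" "g \<notin> relation_ideal"
  shows "f * (1 + \<alpha> * \<chi>) \<in> relation_ideal"
proof -
  obtain t m where m: "nf f = pCons t m" by (metis pCons_cases)
  with coeff_nf_eq_0_if_left_zero_divisor[OF assms] have "from_nf (nf f) = from_nf m * \<alpha>"
    by (simp add: from_nf_pCons)
  then have "from_nf m * \<alpha> + f \<in> relation_ideal"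
    using from_nf_nf[of f] by simp
  from relation_ideal_mult_right[OF this, of "1 + \<alpha> * \<chi>"]
  have "from_nf m * relator + f * (1 + \<alpha> * \<chi>) \<in> relation_ideal"
    by (simp add: relator_eq algebra_simps)
  then show ?thesis
    using relation_ideal_mult_left[OF relator_in_relation_ideal] by (rule add_in_relation_idealD)
qed

lemma one_plus_alpha_chi_notin: "1 + \<alpha> * \<chi> \<notin> relation_ideal"
proof -
  have "\<zeta> \<noteq> 0"
    using right_deriv_gen[of Core_z Core_z] by auto
  then show ?thesis
    using nf_embed[of \<zeta>] by (simp add: embed_z flip: nf_eq_0_iff)
qed

lemma alpha_power_notin: "\<alpha> ^ k \<notin> relation_ideal"
proof -
  have "nf (\<alpha> ^ k) \<noteq> 0"
  proof (induction k)
    case 0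
    show ?case by (simp add: nf_def nf.act_one)
  next
    case (Suc k)
    then show ?case
      unfolding power_Suc2 nf_mult nf.act_gen by simp
  qed
  then show ?thesis by (simp add: nf_eq_0_iff)
qed

text \<open>
  If \<open>g \<noteq> 0\<close> in \<open>R\<close>, then \<open>f = f' a\<close> and \<open>f' (a g) = 0\<close>, where the normal form of \<open>f'\<close> has
  smaller degree in \<open>a\<close>. So the process of passing from \<open>g\<close> to \<open>a g\<close> stops.
\<close>

lemma alpha_power_annihilates:
  assumes "f * g \<in> relation_ideal" "f \<notin> relation_ideal"
  shows "\<exists>k. \<alpha> ^ k * g \<in> relation_ideal"
proof -
  have "\<exists>k. \<alpha> ^ k * g \<in> relation_ideal" if "from_nf m * g \<in> relation_ideal" "m \<noteq> 0" for m g
    using that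
  proof (induction m arbitrary: g)
    case (pCons t m)
    show ?case
    proof (cases "g \<in> relation_ideal")
      case True
      then show ?thesis by (intro exI[of _ 0]) simp
    next
      case False
      then have "t = 0"
        using coeff_nf_eq_0_if_left_zero_divisor[OF pCons.prems(1)] by (simp add: nf_from_nf)
      then have "from_nf m * (\<alpha> * g) \<in> relation_ideal" "m \<noteq> 0"
        using pCons.prems by (auto simp: from_nf_pCons mult.assoc)
      then obtain k where "\<alpha> ^ k * (\<alpha> * g) \<in> relation_ideal"
        using pCons.IH by blast
      then show ?thesis
        by (intro exI[of _ "Suc k"]) (simp add: power_Suc2 mult.assoc del: power_Suc)
    qed
  qed simp
  moreover have "from_nf (nf f) * g \<in> relation_ideal"
    using add_in_relation_idealD[OF _ assms(1), of "from_nf (nf f) * g"]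
      relation_ideal_mult_right[OF from_nf_nf[of f], of g]
    by (simp add: distrib_right add.commute)
  ultimately show ?thesis
    using assms(2) by (simp add: nf_eq_0_iff)
qed

section \<open>Linear polynomials over a ring\<close>

lemma (in ring) UP_const_annihilates_iff:
  assumes f: "f \<in> carrier (UP R)" and s: "s \<in> carrier R"
  shows "f \<otimes>\<^bsub>UP R\<^esub> up_ring.monom (UP R) s 0 = \<zero>\<^bsub>UP R\<^esub> \<longleftrightarrow>
      (\<forall>n. up_ring.coeff (UP R) f n \<otimes> s = \<zero>)"
    and "up_ring.monom (UP R) s 0 \<otimes>\<^bsub>UP R\<^esub> f = \<zero>\<^bsub>UP R\<^esub> \<longleftrightarrow>
      (\<forall>n. s \<otimes> up_ring.coeff (UP R) f n = \<zero>)"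
proof -
  (* The interpretation below rebinds these names to the polynomial ring. *)
  note cong = finsum_cong' and single = finsum_singleton
  interpret UP_ring R "UP R"
    by unfold_locales
  let ?c = "up_ring.coeff (UP R)" and ?s = "up_ring.monom (UP R) s 0"
  have eq0: "p = \<zero>\<^bsub>UP R\<^esub> \<longleftrightarrow> (\<forall>n. ?c p n = \<zero>)" if "p \<in> carrier (UP R)" for p
    using up_eqI[of p "\<zero>\<^bsub>UP R\<^esub>"] that by auto
  have "?c (f \<otimes>\<^bsub>UP R\<^esub> ?s) n = ?c f n \<otimes> s" for n
  proof -
    have "?c (f \<otimes>\<^bsub>UP R\<^esub> ?s) n = (\<Oplus>i\<in>{..n}. ?c f i \<otimes> ?c ?s (n - i))"
      using f s by simp
    also have "\<dots> = (\<Oplus>i\<in>{..n}. if n = i then ?c f i \<otimes> s else \<zero>)"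
      using f s by (intro cong) auto
    also have "\<dots> = ?c f n \<otimes> s"
      using f s by (intro single) auto
    finally show ?thesis .
  qed
  then show "f \<otimes>\<^bsub>UP R\<^esub> ?s = \<zero>\<^bsub>UP R\<^esub> \<longleftrightarrow> (\<forall>n. ?c f n \<otimes> s = \<zero>)"
    using eq0 f s by simp
  have "?c (?s \<otimes>\<^bsub>UP R\<^esub> f) n = s \<otimes> ?c f n" for n
  proof -
    have "?c (?s \<otimes>\<^bsub>UP R\<^esub> f) n = (\<Oplus>i\<in>{..n}. ?c ?s i \<otimes> ?c f (n - i))"
      using f s by simp
    also have "\<dots> = (\<Oplus>i\<in>{..n}. if 0 = i then s \<otimes> ?c f (n - i) else \<zero>)"
      using f s by (intro cong) auto
    also have "\<dots> = s \<otimes> ?c f n"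
      using f s single[of 0 "{..n}" "\<lambda>i. s \<otimes> ?c f (n - i)"] by simp
    finally show ?thesis .
  qed
  then show "?s \<otimes>\<^bsub>UP R\<^esub> f = \<zero>\<^bsub>UP R\<^esub> \<longleftrightarrow> (\<forall>n. s \<otimes> ?c f n = \<zero>)"
    using eq0 f s by simp
qed

lemma (in ring) coeffs_linear_product_eq_0:
  assumes f: "f \<in> carrier (UP R)" and g: "g \<in> carrier (UP R)"
    and deg: "deg R f \<le> 1" "deg R g \<le> 1" and "f \<otimes>\<^bsub>UP R\<^esub> g = \<zero>\<^bsub>UP R\<^esub>"
  defines "c \<equiv> up_ring.coeff (UP R)"
  shows "c f 0 \<otimes> c g 0 = \<zero>" "c f 0 \<otimes> c g 1 \<oplus> c f 1 \<otimes> c g 0 = \<zero>" "c f 1 \<otimes> c g 1 = \<zero>"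
proof -
  (* The interpretation below rebinds this name to the polynomial ring. *)
  note comm = a_comm
  interpret UP_ring R "UP R"
    by unfold_locales
  have prod: "(\<Oplus>i \<in> {..n}. c f i \<otimes> c g (n - i)) = \<zero>" for n
    using coeff_mult[OF f g, of n] assms(5) by (simp add: c_def)
  have closed: "c f n \<in> carrier R" "c g n \<in> carrier R" for n
    using f g by (simp_all add: c_def)
  have high: "c f (Suc (Suc 0)) = \<zero>" "c g (Suc (Suc 0)) = \<zero>"
    using deg by (auto simp: c_def intro!: deg_aboveD f g)
  show "c f 0 \<otimes> c g 0 = \<zero>"
    using prod[of 0] closed by simp
  show "c f 0 \<otimes> c g 1 \<oplus> c f 1 \<otimes> c g 0 = \<zero>"
    using prod[of 1] closed comm[of "c f 0 \<otimes> c g 1" "c f 1 \<otimes> c g 0"] by simp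
  show "c f 1 \<otimes> c g 1 = \<zero>"
    using prod[of 2] closed high by (simp add: numeral_2_eq_2)
qed

lemma (in ring) linear_coeffs:
  assumes f: "f \<in> carrier (UP R) - {\<zero>\<^bsub>UP R\<^esub>}" and deg: "deg R f \<le> 1"
  defines "c \<equiv> up_ring.coeff (UP R)"
  shows "c f n \<in> carrier R" "c f 0 \<noteq> \<zero> \<or> c f 1 \<noteq> \<zero>" "c f n \<in> {c f 0, c f 1, \<zero>}"
proof -
  interpret UP_ring R "UP R"
    by unfold_locales
  show "c f n \<in> carrier R" using f by (simp add: c_def)
  have high: "c f n = \<zero>" if "n > 1" for n
    using that deg f by (auto simp: c_def intro!: deg_aboveD)
  have small: "n = 0 \<or> n = 1 \<or> n > 1" for n :: nat by auto
  show "c f n \<in> {c f 0, c f 1, \<zero>}"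
    using high small[of n] by auto
  show "c f 0 \<noteq> \<zero> \<or> c f 1 \<noteq> \<zero>"
  proof (rule ccontr)
    assume "\<not> ?thesis"
    then have "c f n = \<zero>" for n
      using high small[of n] by auto
    then have "f = \<zero>\<^bsub>UP R\<^esub>"
      using f by (intro up_eqI) (auto simp: c_def)
    with f show False by simp
  qed
qed

text \<open>
  Both coefficients of \<open>f\<close> are left zero-divisors: this follows from \<open>f\<^sub>0 g\<^sub>0 = 0 = f\<^sub>1 g\<^sub>1\<close> if
  \<open>g\<^sub>0\<close> and \<open>g\<^sub>1\<close> are nonzero, and from \<open>f\<^sub>0 g\<^sub>1 + f\<^sub>1 g\<^sub>0 = 0\<close> in addition if one of them vanishes. So an
  element that all left zero-divisors annihilate works for every \<open>f\<close>.
\<close>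

lemma (in ring) right_linearly_McCoyI:
  assumes e: "e \<in> carrier R - {\<zero>}"
    and ann: "\<And>p q. p \<in> carrier R \<Longrightarrow> q \<in> carrier R \<Longrightarrow> q \<noteq> \<zero> \<Longrightarrow> p \<otimes> q = \<zero> \<Longrightarrow> p \<otimes> e = \<zero>"
  shows "right_linearly_McCoy R"
  unfolding right_linearly_McCoy_def
proof (intro ballI impI, elim conjE)
  fix f g
  assume f: "f \<in> carrier (UP R) - {\<zero>\<^bsub>UP R\<^esub>}" and g: "g \<in> carrier (UP R) - {\<zero>\<^bsub>UP R\<^esub>}"
    and deg: "deg R f \<le> 1" "deg R g \<le> 1" and fg: "f \<otimes>\<^bsub>UP R\<^esub> g = \<zero>\<^bsub>UP R\<^esub>"
  let ?c = "up_ring.coeff (UP R)"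
  note f' = linear_coeffs[OF f deg(1)] and g' = linear_coeffs[OF g deg(2)]
  have prods: "?c f 0 \<otimes> ?c g 0 = \<zero>" "?c f 0 \<otimes> ?c g 1 \<oplus> ?c f 1 \<otimes> ?c g 0 = \<zero>" "?c f 1 \<otimes> ?c g 1 = \<zero>"
    using coeffs_linear_product_eq_0[of f g] f g deg fg by auto
  have "\<exists>q\<in>carrier R - {\<zero>}. ?c f 0 \<otimes> q = \<zero>" "\<exists>q\<in>carrier R - {\<zero>}. ?c f 1 \<otimes> q = \<zero>"
  proof -
    show "\<exists>q\<in>carrier R - {\<zero>}. ?c f 0 \<otimes> q = \<zero>"
    proof (cases "?c g 0 = \<zero>")
      case True
      then show ?thesis using prods g' f'(1) by (intro bexI[of _ "?c g 1"]) auto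
    qed (use prods g' in auto)
    show "\<exists>q\<in>carrier R - {\<zero>}. ?c f 1 \<otimes> q = \<zero>"
    proof (cases "?c g 1 = \<zero>")
      case True
      then show ?thesis using prods g' f'(1) by (intro bexI[of _ "?c g 0"]) auto
    qed (use prods g' in auto)
  qed
  then obtain q0 q1 where q: "q0 \<in> carrier R - {\<zero>}" "?c f 0 \<otimes> q0 = \<zero>"
      "q1 \<in> carrier R - {\<zero>}" "?c f 1 \<otimes> q1 = \<zero>"
    by auto
  have "?c f 0 \<otimes> e = \<zero>" "?c f 1 \<otimes> e = \<zero>"
    using ann[OF f'(1), of q0 0] ann[OF f'(1), of q1 1] q by auto
  then have "?c f n \<otimes> e = \<zero>" for n
    using f'(3)[of n] e by auto
  then show "\<exists>s\<in>carrier R - {\<zero>}. f \<otimes>\<^bsub>UP R\<^esub> up_ring.monom (UP R) s 0 = \<zero>\<^bsub>UP R\<^esub>"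
    using e f by (intro bexI[of _ e]) (auto simp: UP_const_annihilates_iff)
qed

text \<open>
  As on the other side, both coefficients of \<open>g\<close> are right zero-divisors, and powers of one
  element have common multiples.
\<close>

lemma (in ring) left_linearly_McCoyI:
  assumes a: "a \<in> carrier R" and a_power: "\<And>k::nat. a [^] k \<noteq> \<zero>"
    and ann: "\<And>p q. p \<in> carrier R \<Longrightarrow> q \<in> carrier R \<Longrightarrow> p \<noteq> \<zero> \<Longrightarrow> p \<otimes> q = \<zero> \<Longrightarrow>
      \<exists>k::nat. a [^] k \<otimes> q = \<zero>"
  shows "left_linearly_McCoy R"
  unfolding left_linearly_McCoy_def
proof (intro ballI impI, elim conjE)
  fix f g
  assume f: "f \<in> carrier (UP R) - {\<zero>\<^bsub>UP R\<^esub>}" and g: "g \<in> carrier (UP R) - {\<zero>\<^bsub>UP R\<^esub>}"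
    and deg: "deg R f \<le> 1" "deg R g \<le> 1" and fg: "f \<otimes>\<^bsub>UP R\<^esub> g = \<zero>\<^bsub>UP R\<^esub>"
  let ?c = "up_ring.coeff (UP R)"
  note f' = linear_coeffs[OF f deg(1)] and g' = linear_coeffs[OF g deg(2)]
  have prods: "?c f 0 \<otimes> ?c g 0 = \<zero>" "?c f 0 \<otimes> ?c g 1 \<oplus> ?c f 1 \<otimes> ?c g 0 = \<zero>" "?c f 1 \<otimes> ?c g 1 = \<zero>"
    using coeffs_linear_product_eq_0[of f g] f g deg fg by auto
  have "\<exists>p\<in>carrier R - {\<zero>}. p \<otimes> ?c g 0 = \<zero>" "\<exists>p\<in>carrier R - {\<zero>}. p \<otimes> ?c g 1 = \<zero>"
  proof -
    show "\<exists>p\<in>carrier R - {\<zero>}. p \<otimes> ?c g 0 = \<zero>"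
    proof (cases "?c f 0 = \<zero>")
      case True
      then show ?thesis using prods f' g'(1) by (intro bexI[of _ "?c f 1"]) auto
    qed (use prods f' in auto)
    show "\<exists>p\<in>carrier R - {\<zero>}. p \<otimes> ?c g 1 = \<zero>"
    proof (cases "?c f 1 = \<zero>")
      case True
      then show ?thesis using prods f' g'(1) by (intro bexI[of _ "?c f 0"]) auto
    qed (use prods f' in auto)
  qed
  then obtain p0 p1 where p: "p0 \<in> carrier R - {\<zero>}" "p0 \<otimes> ?c g 0 = \<zero>"
      "p1 \<in> carrier R - {\<zero>}" "p1 \<otimes> ?c g 1 = \<zero>"
    by auto
  obtain k l :: nat where k: "a [^] k \<otimes> ?c g 0 = \<zero>" and l: "a [^] l \<otimes> ?c g 1 = \<zero>"
    using ann[OF _ g'(1), of p0 0] ann[OF _ g'(1), of p1 1] p by auto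
  have "a [^] (l + k) \<otimes> ?c g 0 = \<zero>"
    using k a g'(1) by (simp add: m_assoc flip: nat_pow_mult)
  moreover have "a [^] (k + l) \<otimes> ?c g 1 = \<zero>"
    using l a g'(1) by (simp add: m_assoc flip: nat_pow_mult)
  ultimately have "a [^] (k + l) \<otimes> ?c g n = \<zero>" for n
    using g'(3)[of n] a by (auto simp: add.commute)
  then show "\<exists>s\<in>carrier R - {\<zero>}. up_ring.monom (UP R) s 0 \<otimes>\<^bsub>UP R\<^esub> g = \<zero>\<^bsub>UP R\<^esub>"
    using a a_power g by (intro bexI[of _ "a [^] (k + l)"]) (auto simp: UP_const_annihilates_iff)
qed

section \<open>The ring is linearly McCoy\<close>

definition to_R :: "(generator, bit) free_algebra \<Rightarrow> (generator, bit) free_algebra set" where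
  "to_R f = relation_ideal +>\<^bsub>F2_free\<^esub> f"

lemma carrier_ring_R: "carrier ring_R = range to_R"
  unfolding ring_R_def FactRing_def relation_ideal_def[symmetric] A_RCOSETS_def'
  by (auto simp: to_R_def)

lemma to_R_in_carrier [simp]: "to_R f \<in> carrier ring_R"
  by (simp add: carrier_ring_R)

lemma to_R_mult: "to_R f \<otimes>\<^bsub>ring_R\<^esub> to_R g = to_R (f * g)"
  unfolding ring_R_def FactRing_def relation_ideal_def[symmetric] to_R_def
  using ideal.rcoset_mult_add[OF relation_ideal_ideal, of f g] by simp

lemma to_R_one: "\<one>\<^bsub>ring_R\<^esub> = to_R 1"
  unfolding ring_R_def FactRing_def relation_ideal_def[symmetric] to_R_def by simp

lemma to_R_eq_zero_iff: "to_R f = \<zero>\<^bsub>ring_R\<^esub> \<longleftrightarrow> f \<in> relation_ideal"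
proof -
  have "\<zero>\<^bsub>ring_R\<^esub> = relation_ideal"
    unfolding ring_R_def FactRing_def relation_ideal_def[symmetric] by simp
  moreover have "to_R f = relation_ideal" if "f \<in> relation_ideal"
    unfolding to_R_def using ring.a_rcos_zero[OF ring_ring_of_type_algebra relation_ideal_ideal that] .
  moreover have "f \<in> to_R f"
    unfolding to_R_def
    using abelian_subgroup.a_rcos_self[OF abelian_subgroupI3[OF relation_ideal_subgroup
      ring.is_abelian_group[OF ring_ring_of_type_algebra]]] by simp
  ultimately show ?thesis by auto
qed

lemma to_R_power: "to_R f [^]\<^bsub>ring_R\<^esub> (k::nat) = to_R (f ^ k)"
proof -
  interpret ring ring_R by (rule ring_ring_R)
  show ?thesis
    by (induction k) (simp_all add: to_R_one to_R_mult power_Suc2 del: power_Suc)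
qed

theorem theorem3p16:
  shows "left_linearly_McCoy ring_R \<and> right_linearly_McCoy ring_R"
proof
  show "left_linearly_McCoy ring_R"
  proof (rule ring.left_linearly_McCoyI[OF ring_ring_R, of "to_R \<alpha>"])
    fix p q
    assume "p \<in> carrier ring_R" "q \<in> carrier ring_R" and p: "p \<noteq> \<zero>\<^bsub>ring_R\<^esub>" "p \<otimes>\<^bsub>ring_R\<^esub> q = \<zero>\<^bsub>ring_R\<^esub>"
    then obtain f g where fg: "p = to_R f" "q = to_R g" by (auto simp: carrier_ring_R)
    have "\<exists>k. \<alpha> ^ k * g \<in> relation_ideal"
      using p unfolding fg to_R_mult to_R_eq_zero_iff by (rule alpha_power_annihilates[rotated])
    then show "\<exists>k::nat. to_R \<alpha> [^]\<^bsub>ring_R\<^esub> k \<otimes>\<^bsub>ring_R\<^esub> q = \<zero>\<^bsub>ring_R\<^esub>"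
      unfolding fg to_R_power to_R_mult to_R_eq_zero_iff .
  qed (simp_all add: to_R_power to_R_eq_zero_iff alpha_power_notin)
  show "right_linearly_McCoy ring_R"
  proof (rule ring.right_linearly_McCoyI[OF ring_ring_R, of "to_R (1 + \<alpha> * \<chi>)"])
    fix p q
    assume "p \<in> carrier ring_R" "q \<in> carrier ring_R" and q: "q \<noteq> \<zero>\<^bsub>ring_R\<^esub>" "p \<otimes>\<^bsub>ring_R\<^esub> q = \<zero>\<^bsub>ring_R\<^esub>"
    then obtain f g where fg: "p = to_R f" "q = to_R g" by (auto simp: carrier_ring_R)
    show "p \<otimes>\<^bsub>ring_R\<^esub> to_R (1 + \<alpha> * \<chi>) = \<zero>\<^bsub>ring_R\<^esub>"
      using q unfolding fg to_R_mult to_R_eq_zero_iff by (rule left_zero_divisor_annihilates[rotated])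
  qed (simp add: to_R_eq_zero_iff one_plus_alpha_chi_notin)
qed

end
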